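(* Let $N\ge 2$ and let $\rho_N'$ be the $N$-qubit cat state after the independent Pauli channel with probabilities $\pi_0,\pi_1,\pi_2,\pi_3$ has acted on every qubit. (i) If $\rho_N'$ is entangled across the $1:(N-1)$ cut, then it is entangled across all other bipartite cuts. (ii) The most robust bipartite cut is $N/2:N/2$ if $N$ is even, and $(N\pm1)/2:(N\mp1)/2$ if $N$ is odd; that is, for every choice of $\pi_0,\dots,\pi_3$, if $\rho_N'$ is entangled across some bipartite cut, then it is entangled across the cut $\lfloor N/2\rfloor:\lceil N/2\rceil$.
   Context: Setting: $\pi_0,\pi_1,\pi_2,\pi_3\ge 0$ with $\sum_{i=0}^3\pi_i=1$. The single-qubit channel is $S(\rho)=\pi_0\rho+\sum_{i=1}^3\pi_i\sigma_i\rho\sigma_i$, where $\sigma_1,\sigma_2,\sigma_3$ are the Pauli matrices $\sigma_x,\sigma_y,\sigma_z$. The $N$-qubit cat (GHZ) state is $|\Psi\rangle_N=\frac{1}{\sqrt2}(|0\rangle^{\otimes N}+|1\rangle^{\otimes N})$, and $\rho_N'=S^{\otimes N}(|\Psi\rangle_N\langle\Psi|)$. A bipartite cut of type $k:(N-k)$ is a division of the $N$ qubits into a set $A$ of $k$ qubits and its complement, with both sides nonempty. Since $\rho_N'$ is invariant under permutations of the qubits, whether it is entangled across a cut depends only on the type of the cut. A state is entangled across a cut if it is not a convex combination of states of the form $\rho_A\otimes\rho_{A^c}$. Robustness means the ability of the state to remain entangled under the noise. *)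

theory Defs
  imports "HOL-Analysis.Analysis"
begin

text \<open>
  Qubits are labelled by natural numbers. The computational basis of a set \<open>A\<close> of qubits
  consists of the bit strings on \<open>A\<close> (\<open>False\<close> for 0, \<open>True\<close> for 1), and an operator on
  these qubits is given by its matrix entries \<open>M x y = \<langle>x|M|y\<rangle>\<close> for \<open>x, y \<in> basis A\<close>.
  Entries outside the basis are irrelevant.
\<close>

type_synonym qubit_op = "(nat \<Rightarrow> bool) \<Rightarrow> (nat \<Rightarrow> bool) \<Rightarrow> complex"

definition basis :: "nat set \<Rightarrow> (nat \<Rightarrow> bool) set" where
  "basis A = A \<rightarrow>\<^sub>E UNIV"

text \<open>Over the complex numbers, a real quadratic form already forces \<open>M\<close> to be Hermitian.\<close>

definition positive_op :: "nat set \<Rightarrow> qubit_op \<Rightarrow> bool" where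
  "positive_op A M \<longleftrightarrow>
     (\<forall>v :: (nat \<Rightarrow> bool) \<Rightarrow> complex.
        (\<Sum>x\<in>basis A. \<Sum>y\<in>basis A. cnj (v x) * M x y * v y) \<in> \<real>\<^sub>\<ge>\<^sub>0)"

definition density_op :: "nat set \<Rightarrow> qubit_op \<Rightarrow> bool" where
  "density_op A M \<longleftrightarrow> positive_op A M \<and> (\<Sum>x\<in>basis A. M x x) = 1"

definition tensor_op :: "nat set \<Rightarrow> nat set \<Rightarrow> qubit_op \<Rightarrow> qubit_op \<Rightarrow> qubit_op" where
  "tensor_op A B M M' =
     (\<lambda>x y. M (restrict x A) (restrict y A) * M' (restrict x B) (restrict y B))"

definition bipartite_cut :: "nat \<Rightarrow> nat \<Rightarrow> nat set \<Rightarrow> bool" where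
  "bipartite_cut N k A \<longleftrightarrow> A \<subseteq> {..<N} \<and> card A = k \<and> 0 < k \<and> k < N"

definition separable_across :: "nat \<Rightarrow> nat set \<Rightarrow> qubit_op \<Rightarrow> bool" where
  "separable_across N A \<rho> \<longleftrightarrow>
     (\<exists>(n::nat) (w :: nat \<Rightarrow> real) (\<alpha> :: nat \<Rightarrow> qubit_op) (\<beta> :: nat \<Rightarrow> qubit_op).
        (\<forall>i<n. 0 \<le> w i \<and> density_op A (\<alpha> i) \<and> density_op ({..<N} - A) (\<beta> i)) \<and>
        (\<Sum>i<n. w i) = 1 \<and>
        (\<forall>x\<in>basis {..<N}. \<forall>y\<in>basis {..<N}.
           \<rho> x y = (\<Sum>i<n. of_real (w i) * tensor_op A ({..<N} - A) (\<alpha> i) (\<beta> i) x y)))"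

abbreviation entangled_across :: "nat \<Rightarrow> nat set \<Rightarrow> qubit_op \<Rightarrow> bool" where
  "entangled_across N A \<rho> \<equiv> \<not> separable_across N A \<rho>"

text \<open>
  Matrices of a single qubit: row and column index \<open>False\<close> is 0, \<open>True\<close> is 1.
  Index 0 is the identity, indices 1, 2, 3 are the Pauli matrices x, y, z.
\<close>

definition pauli :: "nat \<Rightarrow> complex^bool^bool" where
  "pauli i =
     (if i = 1 then (\<chi> a b. if a \<noteq> b then 1 else 0)
      else if i = 2 then (\<chi> a b. if \<not> a \<and> b then - \<i> else if a \<and> \<not> b then \<i> else 0)
      else if i = 3 then (\<chi> a b. if a \<noteq> b then 0 else if a then - 1 else 1)
      else mat 1)"

definition pauli_channel :: "(nat \<Rightarrow> real) \<Rightarrow> complex^bool^bool \<Rightarrow> complex^bool^bool" where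
  "pauli_channel p \<rho> = p 0 *\<^sub>R \<rho> + (\<Sum>i=1..3. p i *\<^sub>R (pauli i ** \<rho> ** pauli i))"

text \<open>
  The \<open>N\<close>-fold tensor power of a linear map \<open>T\<close> on single-qubit matrices: the linear
  extension of \<open>|u\<rangle>\<langle>v| \<mapsto> \<Otimes>\<^sub>q T (|u\<^sub>q\<rangle>\<langle>v\<^sub>q|)\<close>, where
  \<open>axis a (axis b 1)\<close> is the matrix unit \<open>|a\<rangle>\<langle>b|\<close>.
\<close>

definition channel_power ::
  "nat \<Rightarrow> (complex^bool^bool \<Rightarrow> complex^bool^bool) \<Rightarrow> qubit_op \<Rightarrow> qubit_op" where
  "channel_power N T \<rho> =
     (\<lambda>x y. \<Sum>u\<in>basis {..<N}. \<Sum>v\<in>basis {..<N}.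
        \<rho> u v * (\<Prod>q<N. T (axis (u q) (axis (v q) 1)) $ x q $ y q))"

definition cat_state :: "nat \<Rightarrow> (nat \<Rightarrow> bool) \<Rightarrow> complex" where
  "cat_state N x =
     of_real (1 / sqrt 2) *
       ((if \<forall>q<N. \<not> x q then 1 else 0) + (if \<forall>q<N. x q then 1 else 0))"

definition noisy_cat :: "nat \<Rightarrow> (nat \<Rightarrow> real) \<Rightarrow> qubit_op" where
  "noisy_cat N p =
     channel_power N (pauli_channel p) (\<lambda>x y. cat_state N x * cnj (cat_state N y))"

end

theory Submission
  imports Defs
begin

text \<open>
  The noisy cat state has entries only on the diagonal and the antidiagonal. With
  \<open>a = p 0 + p 3\<close>, \<open>b = p 1 + p 2\<close>, \<open>c = p 0 - p 3\<close>, \<open>d = p 1 - p 2\<close>, a bit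
  string with \<open>m\<close> ones carries \<open>D m = (a ^ (N - m) * b ^ m + a ^ m * b ^ (N - m)) / 2\<close> on the
  diagonal and the same expression \<open>X m\<close> in \<open>c, d\<close> on the antidiagonal. Across a cut \<open>A\<close>
  the state splits into two-qubit X-states on the orbits of a bit string under flipping \<open>A\<close> and
  its complement, so it is separable iff its partial transpose is positive, that is, iff
  \<open>\<bar>X (k - i + j)\<bar> \<le> D (i + j)\<close> for all \<open>i \<le> k\<close>, \<open>j \<le> N - k\<close>.
  Both \<open>D\<close> and \<open>\<bar>X\<bar>\<close> are symmetric about \<open>N / 2\<close> and decrease towards it. Hence the
  balanced cut contains the strongest inequality \<open>\<bar>X 0\<bar> \<le> D (N div 2)\<close> of all, while the
  cut \<open>1 : N - 1\<close> only asks for \<open>\<bar>X r\<bar> \<le> D (r + 1)\<close> with \<open>r + 1 \<le> N / 2\<close>, which follows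
  from the inequalities of every other cut.
\<close>

subsection \<open>Weights of the noisy cat state\<close>

definition mix :: "real \<Rightarrow> real \<Rightarrow> nat \<Rightarrow> nat \<Rightarrow> real" where
  "mix a b N m = (a ^ (N - m) * b ^ m + a ^ m * b ^ (N - m)) / 2"

lemma mix_reflect: "m \<le> N \<Longrightarrow> mix a b N (N - m) = mix a b N m"
  by (simp add: mix_def)

text \<open>With \<open>n = N - m - m'\<close> and \<open>t = m' - m\<close>, twice the difference
  of the weights is \<open>a^m * b^m * (a^n - b^n) * (a^t - b^t)\<close>, whose last two factors
  never have opposite signs. The hypotheses place \<open>m'\<close> at least as close to
  \<open>N / 2\<close> as \<open>m\<close>, on either side.\<close>

lemma mix_antimono:
  assumes "0 \<le> a" "0 \<le> b" "m \<le> m'" "m' \<le> N - m"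
  shows "mix a b N m' \<le> mix a b N m"
proof -
  define n t where "n = N - m - m'" and "t = m' - m"
  have e: "m' = m + t" "N - m = m + (t + n)" "N - (m + t) = m + n"
    using assms(3,4) by (auto simp: n_def t_def)
  have "0 \<le> (a ^ n - b ^ n) * (a ^ t - b ^ t)"
  proof (cases "a \<le> b")
    case True
    then have "a ^ n \<le> b ^ n" "a ^ t \<le> b ^ t"
      using assms by (auto intro: power_mono)
    then show ?thesis by (simp add: mult_nonpos_nonpos)
  next
    case False
    then have "b ^ n \<le> a ^ n" "b ^ t \<le> a ^ t"
      using assms by (auto intro: power_mono)
    then show ?thesis by simp
  qed
  then have "0 \<le> a ^ m * b ^ m * ((a ^ n - b ^ n) * (a ^ t - b ^ t))"
    using assms by (intro mult_nonneg_nonneg[of "a ^ m * b ^ m"]) auto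
  also have "\<dots> = 2 * (mix a b N m - mix a b N m')"
    by (simp add: mix_def e power_add algebra_simps)
  finally show ?thesis by simp
qed

text \<open>Squaring reduces the signed case to nonnegative arguments, since the cross term
  \<open>(c * d) ^ N\<close> does not depend on \<open>m\<close>.\<close>

lemma mix_square:
  assumes "m \<le> N"
  shows "(mix c d N m)\<^sup>2 = (mix (c\<^sup>2) (d\<^sup>2) N m + (c * d) ^ N) / 2"
proof -
  have N: "c ^ N = c ^ (N - m) * c ^ m" "d ^ N = d ^ (N - m) * d ^ m"
    using assms by (simp_all flip: power_add)
  show ?thesis
    by (simp add: mix_def N power_mult_distrib power2_eq_square field_simps)
qed

lemma abs_mix_antimono:
  assumes "m \<le> m'" "m' \<le> N - m"
  shows "\<bar>mix c d N m'\<bar> \<le> \<bar>mix c d N m\<bar>"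
proof -
  have "mix (c\<^sup>2) (d\<^sup>2) N m' \<le> mix (c\<^sup>2) (d\<^sup>2) N m"
    using assms by (intro mix_antimono) auto
  then show ?thesis
    using assms by (simp add: abs_le_square_iff mix_square)
qed

text \<open>Supplies the positivity of the noisy state itself: its antidiagonal entries are
  dominated by its diagonal ones.\<close>

lemma abs_mix_le_mix:
  assumes "\<bar>c\<bar> \<le> a" "\<bar>d\<bar> \<le> b"
  shows "\<bar>mix c d N m\<bar> \<le> mix a b N m"
proof -
  have "\<bar>c ^ i * d ^ j\<bar> \<le> a ^ i * b ^ j" for i j
    unfolding abs_mult power_abs using assms by (intro mult_mono power_mono) auto
  from this[of "N - m" m] this[of m "N - m"] show ?thesis
    unfolding mix_def abs_divide by (simp add: abs_le_iff)
qed

text \<open>Here \<open>i\<close> and \<open>j\<close> count the ones of a bit string inside and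
  outside a set of \<open>k\<close> qubits, so flipping that set leaves \<open>k - i + j\<close>
  ones. Each inequality is the positivity of one 2 by 2 block of the partial transpose.\<close>

definition ppt_bound :: "real \<Rightarrow> real \<Rightarrow> real \<Rightarrow> real \<Rightarrow> nat \<Rightarrow> nat \<Rightarrow> bool" where
  "ppt_bound a b c d N k \<longleftrightarrow>
     (\<forall>i\<le>k. \<forall>j\<le>N - k. \<bar>mix c d N (k - i + j)\<bar> \<le> mix a b N (i + j))"

lemma ppt_boundD:
  "ppt_bound a b c d N k \<Longrightarrow> i \<le> k \<Longrightarrow> j \<le> N - k \<Longrightarrow>
     \<bar>mix c d N (k - i + j)\<bar> \<le> mix a b N (i + j)"
  by (simp add: ppt_bound_def)

text \<open>If one side of the cut has at most \<open>r\<close> qubits (cases 1 and 3), fill that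
  side with ones and top up to \<open>r + 1\<close> ones from the other side; the antidiagonal
  argument then lies at least as far from \<open>N / 2\<close> as \<open>r\<close>. If both sides
  have more than \<open>r\<close> qubits, put ones exactly on the \<open>k\<close> side: this gives
  the largest antidiagonal weight, and \<open>k\<close> lies at least as close to
  \<open>N / 2\<close> as \<open>r + 1\<close>.\<close>

lemma ppt_bound_step:
  assumes C: "ppt_bound a b c d N k" and k: "1 \<le> k" "k < N"
    and ab: "0 \<le> a" "0 \<le> b" and r: "2 * (r + 1) \<le> N"
  shows "\<bar>mix c d N r\<bar> \<le> mix a b N (r + 1)"
proof -
  consider "k \<le> r" | "r + 1 \<le> k" "k \<le> N - (r + 1)" | "N - r \<le> k"
    using r by linarith
  then show ?thesis
  proof cases
    case 1
    have "\<bar>mix c d N r\<bar> \<le> \<bar>mix c d N (r + 1 - k)\<bar>"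
      using 1 r k by (intro abs_mix_antimono) auto
    also have "\<dots> \<le> mix a b N (r + 1)"
      using ppt_boundD[OF C, of k "r + 1 - k"] 1 r by simp
    finally show ?thesis .
  next
    case 2
    have "\<bar>mix c d N r\<bar> \<le> \<bar>mix c d N 0\<bar>"
      using r by (intro abs_mix_antimono) auto
    also have "\<dots> \<le> mix a b N k"
      using ppt_boundD[OF C, of k 0] by simp
    also have "\<dots> \<le> mix a b N (r + 1)"
      using 2 ab by (intro mix_antimono) auto
    finally show ?thesis .
  next
    case 3
    \<comment> \<open>The number of ones left for the \<open>k\<close> side when the other side is
      full and the total is \<open>r + 1\<close>.\<close>
    define s where "s = r + 1 - (N - k)"
    have s: "s \<le> r" "s + (N - k) = r + 1" "s \<le> k" "k - s + (N - k) = N - s" "s \<le> N"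
      using 3 k r by (auto simp: s_def)
    have "\<bar>mix c d N r\<bar> \<le> \<bar>mix c d N s\<bar>"
      using s r by (intro abs_mix_antimono) auto
    also have "\<dots> = \<bar>mix c d N (N - s)\<bar>"
      using s by (simp add: mix_reflect)
    also have "\<dots> \<le> mix a b N (r + 1)"
      using ppt_boundD[OF C, of s "N - k"] s by simp
    finally show ?thesis .
  qed
qed

text \<open>For a single qubit the arguments \<open>i + j\<close> and \<open>1 - i + j\<close>
  differ by exactly one. Folding \<open>i + j\<close> to \<open>l <= N / 2\<close> by reflection
  therefore leaves \<open>l - 1\<close> as the worst antidiagonal argument, which
  \<open>ppt_bound_step\<close> handles.\<close>

lemma ppt_bound_imp_one:
  assumes C: "ppt_bound a b c d N k" and k: "1 \<le> k" "k < N"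
    and ab: "0 \<le> a" "0 \<le> b"
  shows "ppt_bound a b c d N 1"
  unfolding ppt_bound_def
proof (intro allI impI)
  fix i j :: nat assume ij: "i \<le> 1" "j \<le> N - 1"
  define l where "l = min (i + j) (N - (i + j))"
  have m: "i + j \<le> N" using ij k by auto
  have D: "mix a b N (i + j) = mix a b N l"
    using m by (auto simp: l_def min_def mix_reflect)
  have "\<bar>mix c d N (1 - i + j)\<bar> \<le> \<bar>mix c d N (l - 1)\<bar>"
    using ij k m by (intro abs_mix_antimono) (auto simp: l_def)
  also have "\<dots> \<le> mix a b N (l - 1 + 1)"
    using k m by (intro ppt_bound_step[OF C k ab]) (auto simp: l_def)
  \<comment> \<open>For \<open>l = 0\<close> truncated subtraction makes \<open>l - 1 + 1\<close>
    equal to 1, and the weight at 1 is at most the weight at 0; otherwise both sides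
    coincide.\<close>
  also have "\<dots> \<le> mix a b N l"
    using k m by (intro mix_antimono ab) (auto simp: l_def)
  finally show "\<bar>mix c d N (1 - i + j)\<bar> \<le> mix a b N (i + j)"
    by (simp add: D)
qed

text \<open>The instance \<open>i = k\<close>, \<open>j = 0\<close> bounds the largest antidiagonal
  weight by the diagonal weight at \<open>k\<close>, which is the smallest one when \<open>k\<close>
  is a middle value.\<close>

lemma ppt_bound_half_imp:
  assumes C: "ppt_bound a b c d N k" and k: "k \<in> {N div 2, N - N div 2}"
    and k': "k' \<le> N" and ab: "0 \<le> a" "0 \<le> b"
  shows "ppt_bound a b c d N k'"
  unfolding ppt_bound_def
proof (intro allI impI)
  fix i j :: nat assume ij: "i \<le> k'" "j \<le> N - k'"
  define l where "l = min (i + j) (N - (i + j))"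
  have m: "i + j \<le> N" using ij k' by auto
  have "\<bar>mix c d N (k' - i + j)\<bar> \<le> \<bar>mix c d N 0\<bar>"
    using ij k' by (intro abs_mix_antimono) auto
  also have "\<dots> \<le> mix a b N k"
    using ppt_boundD[OF C, of k 0] by simp
  also have "\<dots> \<le> mix a b N l"
    using k m by (intro mix_antimono ab) (auto simp: l_def)
  also have "\<dots> = mix a b N (i + j)"
    using m by (auto simp: l_def min_def mix_reflect)
  finally show "\<bar>mix c d N (k' - i + j)\<bar> \<le> mix a b N (i + j)" .
qed

subsection \<open>Flipping qubits\<close>

definition flip :: "nat set \<Rightarrow> (nat \<Rightarrow> bool) \<Rightarrow> nat \<Rightarrow> bool" where
  "flip S x = (\<lambda>q. if q \<in> S then \<not> x q else x q)"

lemma finite_basis [simp]: "finite A \<Longrightarrow> finite (basis A)"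
  by (simp add: basis_def finite_PiE)

lemma restrict_in_basis [simp]: "restrict x A \<in> basis A"
  by (simp add: basis_def)

lemma flip_in_basis [simp]: "S \<subseteq> V \<Longrightarrow> x \<in> basis V \<Longrightarrow> flip S x \<in> basis V"
  by (auto simp: basis_def flip_def PiE_def extensional_def)

lemma flip_eq_self_iff: "flip S x = x \<longleftrightarrow> S = {}"
  by (auto simp: flip_def fun_eq_iff)

lemma flip_empty [simp]: "flip {} x = x"
  by (simp add: flip_def)

lemma flip_eq_iff: "flip S x = flip T x \<longleftrightarrow> S = T"
proof
  assume "flip S x = flip T x"
  then have "q \<in> S \<longleftrightarrow> q \<in> T" for q
    by (auto simp: flip_def fun_eq_iff split: if_splits)
  then show "S = T" by blast
qed simp

lemma basis_eqI:
  "x \<in> basis V \<Longrightarrow> y \<in> basis V \<Longrightarrow> (\<And>q. q \<in> V \<Longrightarrow> x q = y q) \<Longrightarrow> x = y"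
  unfolding basis_def by (rule PiE_ext)

lemma basis_eq_iff_restrict:
  assumes "x \<in> basis V" "y \<in> basis V" "A \<subseteq> V"
  shows "x = y \<longleftrightarrow> restrict x A = restrict y A \<and> restrict x (V - A) = restrict y (V - A)"
proof
  assume r: "restrict x A = restrict y A \<and> restrict x (V - A) = restrict y (V - A)"
  show "x = y"
  proof (rule basis_eqI[OF assms(1,2)])
    fix q assume "q \<in> V"
    then show "x q = y q"
      using r[THEN conjunct1, THEN fun_cong, of q] r[THEN conjunct2, THEN fun_cong, of q]
      by (cases "q \<in> A") auto
  qed
qed simp

lemma sum_basis_split:
  fixes f g :: "(nat \<Rightarrow> bool) \<Rightarrow> complex"
  assumes "A \<subseteq> V"
  shows "(\<Sum>x\<in>basis V. f (restrict x A) * g (restrict x (V - A))) =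
    (\<Sum>x\<in>basis A. f x) * (\<Sum>y\<in>basis (V - A). g y)"
proof -
  have "(\<Sum>x\<in>basis V. f (restrict x A) * g (restrict x (V - A))) =
      (\<Sum>(u, w)\<in>basis A \<times> basis (V - A). f u * g w)"
  proof (rule sum.reindex_bij_witness
      [where i = "\<lambda>(u, w) q. if q \<in> A then u q else w q"
         and j = "\<lambda>x. (restrict x A, restrict x (V - A))"])
    fix x assume "x \<in> basis V"
    then show "(case (restrict x A, restrict x (V - A)) of
        (u, w) \<Rightarrow> \<lambda>q. if q \<in> A then u q else w q) = x"
      using assms by (auto simp: basis_def PiE_def extensional_def fun_eq_iff)
  qed (use assms in \<open>auto simp: basis_def PiE_def extensional_def fun_eq_iff\<close>)
  also have "\<dots> = (\<Sum>x\<in>basis A. f x) * (\<Sum>y\<in>basis (V - A). g y)"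
    by (simp add: sum_product sum.cartesian_product)
  finally show ?thesis .
qed

subsection \<open>Positive operators\<close>

text \<open>Restricts the quadratic form to the span of two basis vectors, which reduces entry
  estimates to 2 by 2 matrices.\<close>

lemma positive_op_two_point:
  assumes M: "positive_op A M" and A: "finite A" and x: "x \<in> basis A" and y: "y \<in> basis A"
    and ne: "x \<noteq> y"
  shows "cnj s * M x x * s + cnj s * M x y * t + cnj t * M y x * s + cnj t * M y y * t \<in> \<real>\<^sub>\<ge>\<^sub>0"
proof -
  define v where "v z = (if z = x then s else if z = y then t else 0)" for z
  have "(\<Sum>z\<in>basis A. cnj (v u) * M u z * v z) = cnj (v u) * M u x * s + cnj (v u) * M u y * t" for u
  proof -
    have "(\<Sum>z\<in>basis A. cnj (v u) * M u z * v z) = (\<Sum>z\<in>{x,y}. cnj (v u) * M u z * v z)"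
      using A x y by (intro sum.mono_neutral_right) (auto simp: v_def)
    then show ?thesis using ne by (simp add: v_def)
  qed
  then have "(\<Sum>u\<in>basis A. \<Sum>z\<in>basis A. cnj (v u) * M u z * v z) =
      (\<Sum>u\<in>basis A. cnj (v u) * M u x * s + cnj (v u) * M u y * t)"
    by simp
  also have "\<dots> = (\<Sum>u\<in>{x,y}. cnj (v u) * M u x * s + cnj (v u) * M u y * t)"
    using A x y by (intro sum.mono_neutral_right) (auto simp: v_def)
  also have "\<dots> = cnj s * M x x * s + cnj s * M x y * t + cnj t * M y x * s + cnj t * M y y * t"
    using ne by (simp add: v_def)
  finally show ?thesis
    using M[unfolded positive_op_def, THEN spec, of v] by (simp only:)
qed

lemma positive_op_diag:
  assumes M: "positive_op A M" and A: "finite A" and x: "x \<in> basis A"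
  shows "M x x \<in> \<real>\<^sub>\<ge>\<^sub>0"
proof -
  define v :: "(nat \<Rightarrow> bool) \<Rightarrow> complex" where "v z = (if z = x then 1 else 0)" for z
  have "(\<Sum>u\<in>basis A. \<Sum>z\<in>basis A. cnj (v u) * M u z * v z) = (\<Sum>u\<in>basis A. cnj (v u) * M u x)"
    using A x by (simp add: v_def if_distrib sum.delta cong: if_cong)
  also have "\<dots> = (\<Sum>u\<in>{x}. cnj (v u) * M u x)"
    using A x by (intro sum.mono_neutral_right) (auto simp: v_def)
  also have "\<dots> = M x x" by (simp add: v_def)
  finally show ?thesis using M[unfolded positive_op_def, THEN spec, of v] by (simp only:)
qed

text \<open>A discriminant argument: for \<open>b > 0\<close> the quadratic is evaluated at its
  minimum \<open>l = m / b\<close>.\<close>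

lemma quadratic_nonneg_imp:
  fixes a b m :: real
  assumes q: "\<And>l. 0 \<le> a - 2 * l * m + l\<^sup>2 * b" and "0 \<le> b" "0 \<le> m"
  shows "m\<^sup>2 \<le> a * b"
proof (cases "b = 0")
  case True
  have "m = 0"
  proof (rule ccontr)
    assume "m \<noteq> 0"
    \<comment> \<open>With \<open>b = 0\<close> the expression is affine in \<open>l\<close>, and
      this \<open>l\<close> gives it the value -1.\<close>
    then show False using q[of "(a + 1) / (2 * m)"] True by simp
  qed
  then show ?thesis using True by simp
next
  case False
  then have b: "0 < b" using assms by simp
  have "0 \<le> b * (a - 2 * (m / b) * m + (m / b)\<^sup>2 * b)"
    using q[of "m / b"] b by (intro mult_nonneg_nonneg) auto
  also have "\<dots> = a * b - m\<^sup>2"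
    using b by (simp add: field_simps power2_eq_square)
  finally show ?thesis by simp
qed

lemma positive_op_entry_bound:
  assumes M: "positive_op A M" and A: "finite A" and x: "x \<in> basis A" and y: "y \<in> basis A"
  shows "(cmod (M x y))\<^sup>2 \<le> Re (M x x) * Re (M y y)"
proof (cases "x = y")
  case True
  then show ?thesis
    using positive_op_diag[OF M A x]
    by (auto simp: complex_nonneg_Reals_iff cmod_def power2_eq_square)
next
  case False
  note two = positive_op_two_point[OF M A x y False]
  have dx: "Im (M x x) = 0" and dy: "Im (M y y) = 0" "0 \<le> Re (M y y)"
    using positive_op_diag[OF M A x] positive_op_diag[OF M A y]
    by (auto simp: complex_nonneg_Reals_iff)
  \<comment> \<open>Reality of the form at the vectors (1, 1) and (1, i) forces the two off-diagonal
    entries to be conjugate.\<close>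
  have "Im (M y x) = - Im (M x y)"
    using two[of 1 1] dx dy by (simp add: complex_nonneg_Reals_iff)
  moreover have "Re (M y x) = Re (M x y)"
    using two[of 1 \<i>] dx dy by (simp add: complex_nonneg_Reals_iff)
  ultimately have h: "M y x = cnj (M x y)" by (simp add: complex_eq_iff)
  \<comment> \<open>The phase \<open>e\<close> makes the off-diagonal entry real and nonnegative, so
    that vectors (1, -l e) with real \<open>l\<close> yield a real quadratic in
    \<open>l\<close>.\<close>
  obtain e where e: "cmod e = 1" "e * M x y = of_real (cmod (M x y))"
  proof (cases "M x y = 0")
    case True
    then show ?thesis using that[of 1] by simp
  next
    case False
    show ?thesis
    proof (rule that[of "cnj (M x y) / of_real (cmod (M x y))"])
      show "cmod (cnj (M x y) / of_real (cmod (M x y))) = 1"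
        using False by (simp add: norm_divide)
      show "cnj (M x y) / of_real (cmod (M x y)) * M x y = of_real (cmod (M x y))"
        using False by (simp add: field_simps complex_norm_square[symmetric] power2_eq_square)
    qed
  qed
  have ee: "cnj e * e = 1"
    using e(1) by (simp add: complex_norm_square[symmetric] mult.commute)
  have "0 \<le> Re (M x x) - 2 * l * cmod (M x y) + l\<^sup>2 * Re (M y y)" for l :: real
  proof -
    define t where "t = - of_real l * e"
    have 1: "M x y * t = - of_real (l * cmod (M x y))"
      using e(2) by (simp add: t_def algebra_simps)
    have 2: "cnj t * M y x = - of_real (l * cmod (M x y))"
      using arg_cong[OF 1, of cnj] by (simp add: h mult.commute)
    have "cnj t * M y y * t = of_real (l\<^sup>2) * (cnj e * e) * M y y"
      by (simp add: t_def power2_eq_square mult_ac)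
    then have 3: "cnj t * M y y * t = of_real (l\<^sup>2) * M y y" by (simp add: ee)
    have "Re (cnj 1 * M x x * 1 + cnj 1 * M x y * t + cnj t * M y x * 1 + cnj t * M y y * t) \<ge> 0"
      using two[of 1 t] by (simp add: complex_nonneg_Reals_iff)
    then show ?thesis using 1 2 3 by simp
  qed
  then show ?thesis
    by (rule quadratic_nonneg_imp) (use dy in auto)
qed

lemma density_op_rank_one:
  assumes "(\<Sum>x\<in>basis A. v x * cnj (v x)) = 1"
  shows "density_op A (\<lambda>x y. v x * cnj (v y))"
proof -
  have "(\<Sum>x\<in>basis A. \<Sum>y\<in>basis A. cnj (u x) * (v x * cnj (v y)) * u y) \<in> \<real>\<^sub>\<ge>\<^sub>0" for u
  proof -
    have "(\<Sum>x\<in>basis A. \<Sum>y\<in>basis A. cnj (u x) * (v x * cnj (v y)) * u y) =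
        (\<Sum>x\<in>basis A. cnj (u x) * v x) * cnj (\<Sum>x\<in>basis A. cnj (u x) * v x)"
      unfolding cnj_sum sum_product by (intro sum.cong) (simp_all add: mult_ac)
    also have "\<dots> = of_real ((cmod (\<Sum>x\<in>basis A. cnj (u x) * v x))\<^sup>2)"
      by (rule complex_norm_square[symmetric])
    finally show ?thesis by simp
  qed
  then show ?thesis using assms by (simp add: density_op_def positive_op_def)
qed


subsection \<open>The cone of separable operators\<close>

text \<open>\<open>separable_across\<close> without the normalization of the weights. This makes the
  set closed under sums and nonnegative multiples, so a state can be assembled from unnormalized
  pieces.\<close>

definition sep_cone :: "nat \<Rightarrow> nat set \<Rightarrow> qubit_op \<Rightarrow> bool" where
  "sep_cone N A \<rho> \<longleftrightarrow>
     (\<exists>(n::nat) (w :: nat \<Rightarrow> real) (\<alpha> :: nat \<Rightarrow> qubit_op) (\<beta> :: nat \<Rightarrow> qubit_op).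
        (\<forall>i<n. 0 \<le> w i \<and> density_op A (\<alpha> i) \<and> density_op ({..<N} - A) (\<beta> i)) \<and>
        (\<forall>x\<in>basis {..<N}. \<forall>y\<in>basis {..<N}.
           \<rho> x y = (\<Sum>i<n. of_real (w i) * tensor_op A ({..<N} - A) (\<alpha> i) (\<beta> i) x y)))"

lemma sep_cone_cong:
  assumes "sep_cone N A M"
    and "\<And>x y. x \<in> basis {..<N} \<Longrightarrow> y \<in> basis {..<N} \<Longrightarrow> M' x y = M x y"
  shows "sep_cone N A M'"
  using assms(1) unfolding sep_cone_def by (simp add: assms(2))

lemma sep_coneI:
  fixes n :: nat
  assumes "\<And>i. i < n \<Longrightarrow> 0 \<le> w i" "\<And>i. i < n \<Longrightarrow> density_op A (\<alpha> i)"
    and "\<And>i. i < n \<Longrightarrow> density_op ({..<N} - A) (\<beta> i)"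
    and "\<And>x y. x \<in> basis {..<N} \<Longrightarrow> y \<in> basis {..<N} \<Longrightarrow>
       \<rho> x y = (\<Sum>i<n. of_real (w i) * tensor_op A ({..<N} - A) (\<alpha> i) (\<beta> i) x y)"
  shows "sep_cone N A \<rho>"
  unfolding sep_cone_def
  by (intro exI[of _ n] exI[of _ w] exI[of _ \<alpha>] exI[of _ \<beta>] conjI allI impI ballI assms)

lemma sep_cone_zero: "sep_cone N A (\<lambda>x y. 0)"
  unfolding sep_cone_def by (rule exI[of _ 0]) simp

lemma sum_lessThan_append:
  fixes f g :: "nat \<Rightarrow> 'a::comm_monoid_add"
  shows "(\<Sum>i<n + m. if i < n then f i else g (i - n)) = (\<Sum>i<n. f i) + (\<Sum>i<m. g i)"
  by (induction m) (simp_all add: add.assoc)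

lemma sep_cone_add:
  assumes "sep_cone N A M" "sep_cone N A M'"
  shows "sep_cone N A (\<lambda>x y. M x y + M' x y)"
proof -
  obtain n w \<alpha> \<beta> where 1: "\<forall>i<n. 0 \<le> w i \<and> density_op A (\<alpha> i) \<and> density_op ({..<N} - A) (\<beta> i)"
    "\<forall>x\<in>basis {..<N}. \<forall>y\<in>basis {..<N}.
       M x y = (\<Sum>i<n::nat. of_real (w i) * tensor_op A ({..<N} - A) (\<alpha> i) (\<beta> i) x y)"
    using assms(1) unfolding sep_cone_def by blast
  obtain m w' \<alpha>' \<beta>' where 2: "\<forall>i<m. 0 \<le> w' i \<and> density_op A (\<alpha>' i) \<and> density_op ({..<N} - A) (\<beta>' i)"
    "\<forall>x\<in>basis {..<N}. \<forall>y\<in>basis {..<N}.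
       M' x y = (\<Sum>i<m::nat. of_real (w' i) * tensor_op A ({..<N} - A) (\<alpha>' i) (\<beta>' i) x y)"
    using assms(2) unfolding sep_cone_def by blast
  define W where "W i = (if i < n then w i else w' (i - n))" for i
  define P where "P i = (if i < n then \<alpha> i else \<alpha>' (i - n))" for i
  define Q where "Q i = (if i < n then \<beta> i else \<beta>' (i - n))" for i
  have "(\<Sum>i<n + m. of_real (W i) * tensor_op A ({..<N} - A) (P i) (Q i) x y) =
      (\<Sum>i<n + m. if i < n then of_real (w i) * tensor_op A ({..<N} - A) (\<alpha> i) (\<beta> i) x y
        else of_real (w' (i - n)) * tensor_op A ({..<N} - A) (\<alpha>' (i - n)) (\<beta>' (i - n)) x y)" for x y
    by (intro sum.cong) (auto simp: W_def P_def Q_def)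
  then have S: "(\<Sum>i<n + m. of_real (W i) * tensor_op A ({..<N} - A) (P i) (Q i) x y) =
      (\<Sum>i<n. of_real (w i) * tensor_op A ({..<N} - A) (\<alpha> i) (\<beta> i) x y) +
      (\<Sum>i<m. of_real (w' i) * tensor_op A ({..<N} - A) (\<alpha>' i) (\<beta>' i) x y)" for x y
    by (rule trans[OF _ sum_lessThan_append])
  have "\<forall>i<n + m. 0 \<le> W i \<and> density_op A (P i) \<and> density_op ({..<N} - A) (Q i)"
    using 1(1) 2(1) by (auto simp: W_def P_def Q_def)
  then show ?thesis
    by (intro sep_coneI[of "n + m" W A P N Q]) (simp_all only: S 1(2) 2(2))
qed

lemma sep_cone_scale:
  assumes "sep_cone N A M" "0 \<le> r"
  shows "sep_cone N A (\<lambda>x y. of_real r * M x y)"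
proof -
  obtain n w \<alpha> \<beta> where 1: "\<forall>i<n. 0 \<le> w i \<and> density_op A (\<alpha> i) \<and> density_op ({..<N} - A) (\<beta> i)"
    "\<forall>x\<in>basis {..<N}. \<forall>y\<in>basis {..<N}.
       M x y = (\<Sum>i<n::nat. of_real (w i) * tensor_op A ({..<N} - A) (\<alpha> i) (\<beta> i) x y)"
    using assms(1) unfolding sep_cone_def by blast
  show ?thesis
    using 1 assms(2)
    by (intro sep_coneI[of n "\<lambda>i. r * w i" A \<alpha> N \<beta>]) (simp_all add: sum_distrib_left mult.assoc)
qed

lemma sep_cone_sum:
  assumes "finite I" "\<And>i. i \<in> I \<Longrightarrow> sep_cone N A (M i)"
  shows "sep_cone N A (\<lambda>x y. \<Sum>i\<in>I. M i x y)"
  using assms by (induction I rule: finite_induct) (auto intro: sep_cone_zero sep_cone_add)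

text \<open>Every product of density operators has trace 1, so the trace of the combination is the
  sum of its weights.\<close>

lemma separable_across_if_sep_cone:
  assumes A: "A \<subseteq> {..<N}" and M: "sep_cone N A M" and tr: "(\<Sum>x\<in>basis {..<N}. M x x) = 1"
  shows "separable_across N A M"
proof -
  obtain n w \<alpha> \<beta> where 1: "\<forall>i<n. 0 \<le> w i \<and> density_op A (\<alpha> i) \<and> density_op ({..<N} - A) (\<beta> i)"
    "\<forall>x\<in>basis {..<N}. \<forall>y\<in>basis {..<N}.
       M x y = (\<Sum>i<n::nat. of_real (w i) * tensor_op A ({..<N} - A) (\<alpha> i) (\<beta> i) x y)"
    using M unfolding sep_cone_def by blast
  have t: "(\<Sum>x\<in>basis {..<N}. tensor_op A ({..<N} - A) (\<alpha> i) (\<beta> i) x x) = 1" if "i < n" for i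
    using 1(1) that sum_basis_split[OF A, of "\<lambda>u. \<alpha> i u u" "\<lambda>u. \<beta> i u u"]
    by (simp add: tensor_op_def density_op_def)
  have "1 = (\<Sum>x\<in>basis {..<N}. \<Sum>i<n. of_real (w i) * tensor_op A ({..<N} - A) (\<alpha> i) (\<beta> i) x x)"
    using tr 1(2) by simp
  also have "\<dots> = (\<Sum>i<n. of_real (w i) * (\<Sum>x\<in>basis {..<N}. tensor_op A ({..<N} - A) (\<alpha> i) (\<beta> i) x x))"
    unfolding sum_distrib_left by (rule sum.swap)
  also have "\<dots> = (\<Sum>i<n. of_real (w i))"
    using t by simp
  finally have "complex_of_real (\<Sum>i<n. w i) = 1" by simp
  then have "(\<Sum>i<n. w i) = 1"
    using of_real_eq_1_iff by blast
  then show ?thesis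
    unfolding separable_across_def using 1 by blast
qed

text \<open>The zero vector has no normalization and is split off as a case of its own.\<close>

lemma rank_one_normalize:
  assumes "finite S"
  obtains "\<And>x. x \<in> S \<Longrightarrow> v x = (0::complex)"
  | c v' where "0 \<le> c" "(\<Sum>x\<in>S. v' x * cnj (v' x)) = 1" "\<And>x. v x = of_real c * v' x"
proof (cases "\<forall>x\<in>S. v x = 0")
  case False
  define r where "r = (\<Sum>x\<in>S. (cmod (v x))\<^sup>2)"
  have "r \<noteq> 0"
    using False assms by (auto simp: r_def sum_nonneg_eq_0_iff)
  moreover have "0 \<le> r" by (simp add: r_def sum_nonneg)
  ultimately have r: "0 < r" by simp
  have "(\<Sum>x\<in>S. (v x / of_real (sqrt r)) * cnj (v x / of_real (sqrt r))) = (\<Sum>x\<in>S. of_real ((cmod (v x))\<^sup>2 / r))"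
    using r by (intro sum.cong) (auto simp flip: complex_norm_square of_real_mult)
  also have "\<dots> = of_real (r / r)"
    by (simp only: r_def sum_divide_distrib of_real_sum)
  finally show ?thesis
    using r by (intro that(2)[of "sqrt r" "\<lambda>x. v x / of_real (sqrt r)"]) auto
qed (use that(1) in auto)

lemma sep_cone_product_vector:
  assumes A: "A \<subseteq> {..<N}"
    and V: "\<And>x. x \<in> basis {..<N} \<Longrightarrow> V x = v (restrict x A) * w (restrict x ({..<N} - A))"
  shows "sep_cone N A (\<lambda>x y. V x * cnj (V y))"
proof -
  have "finite A" using A finite_subset by blast
  then have fin: "finite (basis A)" "finite (basis ({..<N} - A))" by auto
  show ?thesis
  proof (rule rank_one_normalize[OF fin(1), of v])
    assume "\<And>x. x \<in> basis A \<Longrightarrow> v x = 0"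
    then show ?thesis
      by (intro sep_cone_cong[OF sep_cone_zero]) (simp add: V)
  next
    fix c v' assume v': "0 \<le> c" "(\<Sum>x\<in>basis A. v' x * cnj (v' x)) = 1" "\<And>x. v x = of_real c * v' x"
    show ?thesis
    proof (rule rank_one_normalize[OF fin(2), of w])
      assume "\<And>x. x \<in> basis ({..<N} - A) \<Longrightarrow> w x = 0"
      then show ?thesis
        by (intro sep_cone_cong[OF sep_cone_zero]) (simp add: V)
    next
      fix d w' assume w': "0 \<le> d" "(\<Sum>x\<in>basis ({..<N} - A). w' x * cnj (w' x)) = 1"
        "\<And>x. w x = of_real d * w' x"
      show ?thesis
        by (rule sep_coneI[of 1 "\<lambda>_. (c * d)\<^sup>2" A "\<lambda>_ x y. v' x * cnj (v' y)" N
              "\<lambda>_ x y. w' x * cnj (w' y)"])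
          (simp_all add: density_op_rank_one v' w' tensor_op_def V power2_eq_square)
    qed
  qed
qed

subsection \<open>Separability of operators supported on complementary pairs\<close>

lemma flip_restrict:
  "S \<subseteq> A \<Longrightarrow> flip S (restrict x A) = restrict (flip S x) A"
  by (auto simp: flip_def fun_eq_iff)

text \<open>The two prescribed products multiply to the square of \<open>s\<close>, so
  \<open>s\<close> can be real only if the signs agree; opposite signs need \<open>s\<close>
  imaginary.\<close>

lemma ex_phases:
  fixes e1 e2 :: real
  assumes "\<bar>e1\<bar> = 1" "\<bar>e2\<bar> = 1"
  obtains s t :: complex where "s * cnj s = 1" "t * cnj t = 1" "s * t = of_real e1" "s * cnj t = of_real e2"
proof -
  have "e1 = 1 \<or> e1 = -1" "e2 = 1 \<or> e2 = -1" using assms by linarith+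
  then consider "e1 = 1" "e2 = 1" | "e1 = 1" "e2 = -1" | "e1 = -1" "e2 = 1" | "e1 = -1" "e2 = -1"
    by blast
  then show ?thesis
  proof cases
    case 1 then show ?thesis by (intro that[of 1 1]) simp_all
  next
    case 2 then show ?thesis by (intro that[of \<i> "-\<i>"]) simp_all
  next
    case 3 then show ?thesis by (intro that[of \<i> \<i>]) simp_all
  next
    case 4 then show ?thesis by (intro that[of 1 "-1"]) simp_all
  qed
qed

section \<open>Orbits of bit strings under flipping either side of a fixed proper cut\<close>

context
  fixes N :: nat and A :: "nat set"
  assumes A: "A \<subseteq> {..<N}" "A \<noteq> {}" "A \<noteq> {..<N}"
begin

text \<open>An orbit spans a two-qubit space, with \<open>x\<close> and \<open>flip A x\<close> as the two states of the first qubit.\<close>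

definition orbit :: "(nat \<Rightarrow> bool) \<Rightarrow> (nat \<Rightarrow> bool) set" where
  "orbit x = {x, flip A x, flip ({..<N} - A) x, flip {..<N} x}"

lemma compl_nonempty: "{..<N} - A \<noteq> {}"
  using A by auto

lemma flip_compose:
  "flip A (flip A x) = x"
  "flip A (flip ({..<N} - A) x) = flip {..<N} x"
  "flip A (flip {..<N} x) = flip ({..<N} - A) x"
  "flip ({..<N} - A) (flip A x) = flip {..<N} x"
  "flip ({..<N} - A) (flip ({..<N} - A) x) = x"
  "flip ({..<N} - A) (flip {..<N} x) = flip A x"
  "flip {..<N} (flip A x) = flip ({..<N} - A) x"
  "flip {..<N} (flip ({..<N} - A) x) = flip A x"
  "flip {..<N} (flip {..<N} x) = x"
  using A by (auto simp: flip_def fun_eq_iff)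

text \<open>Both sides of the cut being nonempty is what gives every orbit four distinct
  elements.\<close>

lemma flip_distinct:
  "flip A x \<noteq> x" "flip ({..<N} - A) x \<noteq> x" "flip {..<N} x \<noteq> x"
  "flip A x \<noteq> flip ({..<N} - A) x" "flip A x \<noteq> flip {..<N} x"
  "flip ({..<N} - A) x \<noteq> flip {..<N} x"
  using A compl_nonempty by (auto simp: flip_eq_self_iff flip_eq_iff)

lemmas flip_distinct_sym = flip_distinct flip_distinct[symmetric]

lemma orbit_sym: "y \<in> orbit x \<longleftrightarrow> x \<in> orbit y"
  by (auto simp: orbit_def flip_compose)

lemma orbit_subset: "x \<in> basis {..<N} \<Longrightarrow> orbit x \<subseteq> basis {..<N}"
  using A by (auto simp: orbit_def)

lemma card_orbit: "card (orbit x) = 4"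
  by (simp add: orbit_def flip_distinct_sym card_insert_if)

text \<open>Equality with each orbit element splits into one condition on \<open>A\<close> and one
  on its complement, so the four-term vector is the expanded product of two-term vectors.\<close>

lemma product_vector_orbit:
  assumes x: "x \<in> basis {..<N}" and y: "y \<in> basis {..<N}"
  shows "of_bool (y = x) + s * of_bool (y = flip A x) + t * of_bool (y = flip ({..<N} - A) x)
      + s * t * of_bool (y = flip {..<N} x) =
    (of_bool (restrict y A = restrict x A) + s * of_bool (restrict y A = flip A (restrict x A))) *
    ((of_bool (restrict y ({..<N} - A) = restrict x ({..<N} - A))
      + t * of_bool (restrict y ({..<N} - A) = flip ({..<N} - A) (restrict x ({..<N} - A)))) :: complex)"
proof -
  let ?B = "{..<N} - A"
  have eqs: "y = flip S x \<longleftrightarrow> restrict y A = restrict (flip S x) A \<and> restrict y ?B = restrict (flip S x) ?B"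
    if "S \<subseteq> {..<N}" for S
    using basis_eq_iff_restrict[OF y _ A(1)] that x by simp
  have r: "restrict (flip ?B x) A = restrict x A" "restrict (flip A x) ?B = restrict x ?B"
    "restrict (flip {..<N} x) A = restrict (flip A x) A"
    "restrict (flip {..<N} x) ?B = restrict (flip ?B x) ?B"
    using A by (auto simp: flip_def fun_eq_iff)
  have e: "y = x \<longleftrightarrow> restrict y A = restrict x A \<and> restrict y ?B = restrict x ?B"
    using eqs[of "{}"] by simp
  show ?thesis
    using A(1) by (simp add: e eqs r flip_restrict of_bool_conj algebra_simps)
qed

text \<open>
  On one orbit, average the projectors onto
  \<open>(|u\<rangle> + s|u'\<rangle>) \<otimes> (|w\<rangle> + t|w'\<rangle>)\<close> over the sign pairs \<open>\<plusminus>(s, t)\<close>: only the diagonal and the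
  antidiagonal survive, the latter with the two signs \<open>s * t\<close> and \<open>s * cnj t\<close>, which
  can be prescribed.
\<close>

lemma sep_cone_orbit:
  assumes x: "x \<in> basis {..<N}"
    and sym: "\<And>y. f (flip {..<N} y) = f y"
    and abs: "\<And>y. \<bar>f (flip A y)\<bar> = \<bar>f y\<bar>"
  shows "sep_cone N A (\<lambda>y z. of_bool (y \<in> orbit x) *
    (of_real (\<bar>f y\<bar>) * of_bool (z = y) + of_real (f y) * of_bool (z = flip {..<N} y)))"
proof -
  let ?B = "{..<N} - A"
  \<comment> \<open>The function \<open>f\<close> is constant on the complementary pairs of
    \<open>x\<close> and of \<open>flip A x\<close>; these are its signs there. The choice at zero
    is harmless because the modulus of \<open>f\<close> is constant on the orbit.\<close>
  define e1 e2 where "e1 = (if f x \<ge> 0 then 1 else -1 :: real)"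
    and "e2 = (if f (flip A x) \<ge> 0 then 1 else -1 :: real)"
  have fB: "f (flip ?B x) = f (flip A x)"
    using sym[of "flip A x"] by (simp add: flip_compose)
  have f: "f x = \<bar>f x\<bar> * e1" "f (flip A x) = \<bar>f x\<bar> * e2"
    using abs[of x] by (auto simp: e1_def e2_def)
  obtain s t :: complex where st: "s * cnj s = 1" "t * cnj t = 1" "s * t = of_real e1" "s * cnj t = of_real e2"
    by (rule ex_phases[of e1 e2]) (auto simp: e1_def e2_def)
  have st': "cnj s * cnj t = of_real e1" "cnj s * t = of_real e2"
    using arg_cong[OF st(3), of cnj] arg_cong[OF st(4), of cnj] by simp_all
  define V :: "complex \<Rightarrow> complex \<Rightarrow> (nat \<Rightarrow> bool) \<Rightarrow> complex" where
    "V s t y = of_bool (y = x) + s * of_bool (y = flip A x) + t * of_bool (y = flip ?B x)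
      + s * t * of_bool (y = flip {..<N} x)" for s t y
  have V: "sep_cone N A (\<lambda>y z. V s t y * cnj (V s t z))" for s t
    by (rule sep_cone_product_vector[OF A(1), where
          v = "\<lambda>u. of_bool (u = restrict x A) + s * of_bool (u = flip A (restrict x A))" and
          w = "\<lambda>u. of_bool (u = restrict x ?B) + t * of_bool (u = flip ?B (restrict x ?B))"])
      (simp only: V_def product_vector_orbit[OF x])
  \<comment> \<open>Both projectors have diagonal entries 1 on the orbit, hence the factor one
    half.\<close>
  have "sep_cone N A (\<lambda>y z. of_real (\<bar>f x\<bar> / 2) * (V s t y * cnj (V s t z) + V (-s) (-t) y * cnj (V (-s) (-t) z)))"
    by (intro sep_cone_scale sep_cone_add V) simp
  then show ?thesis
  proof (rule sep_cone_cong)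
    fix y z :: "nat \<Rightarrow> bool"
    have V0: "V s t y = 0" if "y \<notin> orbit x" for s t y
      using that by (simp add: V_def orbit_def)
    have V1: "V s t x = 1" "V s t (flip A x) = s" "V s t (flip ?B x) = t" "V s t (flip {..<N} x) = s * t" for s t
      by (simp_all add: V_def flip_distinct_sym)
    have closed: "flip {..<N} y \<in> orbit x" if "y \<in> orbit x"
      using that by (auto simp: orbit_def flip_compose)
    show "of_bool (y \<in> orbit x) *
      (of_real (\<bar>f y\<bar>) * of_bool (z = y) + of_real (f y) * of_bool (z = flip {..<N} y)) =
      of_real (\<bar>f x\<bar> / 2) * (V s t y * cnj (V s t z) + V (-s) (-t) y * cnj (V (-s) (-t) z))"
    proof (cases "y \<in> orbit x \<and> z \<in> orbit x")
      case False
      then show ?thesis using V0 closed by auto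
    next
      case True
      have f': "f (flip ?B x) = \<bar>f x\<bar> * e2" "f (flip {..<N} x) = \<bar>f x\<bar> * e1"
        "\<bar>f (flip A x)\<bar> = \<bar>f x\<bar>" "\<bar>f (flip ?B x)\<bar> = \<bar>f x\<bar>"
        "\<bar>f (flip {..<N} x)\<bar> = \<bar>f x\<bar>"
        using f fB abs[of x] sym[of x] by simp_all
      have ee: "e1 * e1 = 1" "e2 * e2 = 1" by (auto simp: e1_def e2_def)
      have ae: "\<bar>e1\<bar> = 1" "\<bar>e2\<bar> = 1" by (auto simp: e1_def e2_def)
      have comm: "t * cnj s = of_real e2" "\<bar>f x\<bar> * e1 = f x"
        using st'(2) f(1) by (simp_all add: mult.commute)
      have "y = x \<or> y = flip A x \<or> y = flip ?B x \<or> y = flip {..<N} x"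
        "z = x \<or> z = flip A x \<or> z = flip ?B x \<or> z = flip {..<N} x"
        using True by (auto simp: orbit_def)
      then show ?thesis
        using True
        by (elim disjE)
          (simp_all add: V1 flip_compose flip_distinct_sym f'(3-5) f'(1,2) f(2) st st' ee comm(1)
            flip: of_real_mult, simp_all add: abs_mult ae comm(2) mult.commute[of e1])
    qed
  qed
qed

text \<open>Summing the orbit operators over all bit strings counts each orbit once per element,
  that is, four times.\<close>

lemma sep_cone_antidiagonal:
  assumes sym: "\<And>y. f (flip {..<N} y) = f y"
    and abs: "\<And>y. \<bar>f (flip A y)\<bar> = \<bar>f y\<bar>"
  shows "sep_cone N A (\<lambda>y z. of_real (\<bar>f y\<bar>) * of_bool (z = y) + of_real (f y) * of_bool (z = flip {..<N} y))"
proof -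
  define K :: qubit_op where
    "K = (\<lambda>y z. of_real (\<bar>f y\<bar>) * of_bool (z = y) + of_real (f y) * of_bool (z = flip {..<N} y))"
  have "sep_cone N A (\<lambda>y z. of_real (1/4) * (\<Sum>x\<in>basis {..<N}. of_bool (y \<in> orbit x) * K y z))"
    unfolding K_def by (intro sep_cone_scale sep_cone_sum sep_cone_orbit assms) auto
  then have "sep_cone N A K"
  proof (rule sep_cone_cong)
    fix y z :: "nat \<Rightarrow> bool" assume y: "y \<in> basis {..<N}"
    have "(\<Sum>x\<in>basis {..<N}. of_bool (y \<in> orbit x) * K y z) = (\<Sum>x\<in>orbit y. K y z)"
      using orbit_subset[OF y]
      by (intro sum.mono_neutral_cong_right) (auto simp: orbit_sym[of y])
    then show "K y z = of_real (1/4) * (\<Sum>x\<in>basis {..<N}. of_bool (y \<in> orbit x) * K y z)"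
      by (simp add: card_orbit)
  qed
  then show ?thesis unfolding K_def .
qed

lemma sep_cone_diagonal:
  fixes r :: "(nat \<Rightarrow> bool) \<Rightarrow> real"
  assumes "\<And>y. y \<in> basis {..<N} \<Longrightarrow> 0 \<le> r y"
  shows "sep_cone N A (\<lambda>y z. of_real (r y) * of_bool (z = y))"
proof -
  have "sep_cone N A (\<lambda>y z. \<Sum>x\<in>basis {..<N}. of_real (r x) * (of_bool (y = x) * cnj (of_bool (z = x))))"
  proof (intro sep_cone_sum sep_cone_scale assms)
    fix x assume x: "x \<in> basis {..<N}"
    show "sep_cone N A (\<lambda>y z. of_bool (y = x) * cnj (of_bool (z = x)))"
      by (rule sep_cone_product_vector[OF A(1), where v = "\<lambda>u. of_bool (u = restrict x A)"
          and w = "\<lambda>u. of_bool (u = restrict x ({..<N} - A))"])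
        (use basis_eq_iff_restrict[OF _ x A(1)] in \<open>simp add: of_bool_conj\<close>)
  qed auto
  then show ?thesis
  proof (rule sep_cone_cong)
    fix y z :: "nat \<Rightarrow> bool" assume y: "y \<in> basis {..<N}"
    have "(\<Sum>x\<in>basis {..<N}. of_real (r x) * (of_bool (y = x) * cnj (of_bool (z = x)))) =
      (\<Sum>x\<in>basis {..<N}. if y = x then of_real (r y) * of_bool (z = y) else (0::complex))"
      by (intro sum.cong) auto
    then show "of_real (r y) * of_bool (z = y) =
      (\<Sum>x\<in>basis {..<N}. of_real (r x) * (of_bool (y = x) * cnj (of_bool (z = x))) :: complex)"
      using y by (simp add: sum.delta)
  qed
qed

text \<open>Split \<open>X\<close> into its even part \<open>g\<close> and odd part \<open>h\<close>
  under flipping \<open>A\<close>. Each has a modulus invariant under that flip, so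
  \<open>sep_cone_antidiagonal\<close> applies to both, and the rest of the diagonal is nonnegative
  by \<open>XD\<close> and \<open>ppt\<close>.\<close>

lemma separable_across_X_state:
  fixes D X :: "(nat \<Rightarrow> bool) \<Rightarrow> real"
  assumes \<rho>: "\<And>y z. y \<in> basis {..<N} \<Longrightarrow> z \<in> basis {..<N} \<Longrightarrow>
      \<rho> y z = of_real (D y) * of_bool (z = y) + of_real (X y) * of_bool (z = flip {..<N} y)"
    and tr: "(\<Sum>y\<in>basis {..<N}. \<rho> y y) = 1"
    and symD: "\<And>y. D (flip {..<N} y) = D y" and symX: "\<And>y. X (flip {..<N} y) = X y"
    and XD: "\<And>y. y \<in> basis {..<N} \<Longrightarrow> \<bar>X y\<bar> \<le> D y"
    and ppt: "\<And>y. y \<in> basis {..<N} \<Longrightarrow> \<bar>X (flip A y)\<bar> \<le> D y"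
  shows "separable_across N A \<rho>"
proof (rule separable_across_if_sep_cone[where M = \<rho>, OF A(1) _ tr])
  \<comment> \<open>\<open>\<bar>g y\<bar> + \<bar>h y\<bar>\<close> is the maximum of \<open>\<bar>X y\<bar>\<close> and \<open>\<bar>X (flip A y)\<bar>\<close>.\<close>
  define g h where "g y = (X y + X (flip A y)) / 2" and "h y = (X y - X (flip A y)) / 2" for y
  have XA: "X (flip ({..<N} - A) y) = X (flip A y)" for y
    using symX[of "flip A y"] by (simp add: flip_compose)
  have "sep_cone N A (\<lambda>y z.
      (of_real (D y - \<bar>g y\<bar> - \<bar>h y\<bar>) * of_bool (z = y) +
       (of_real \<bar>g y\<bar> * of_bool (z = y) + of_real (g y) * of_bool (z = flip {..<N} y))) +
       (of_real \<bar>h y\<bar> * of_bool (z = y) + of_real (h y) * of_bool (z = flip {..<N} y)))"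
  proof (rule sep_cone_add[OF sep_cone_add[OF sep_cone_diagonal sep_cone_antidiagonal] sep_cone_antidiagonal])
    fix y assume y: "y \<in> basis {..<N}"
    show "0 \<le> D y - \<bar>g y\<bar> - \<bar>h y\<bar>"
      using XD[OF y] ppt[OF y] by (auto simp: g_def h_def abs_if field_simps)
  qed (auto simp: g_def h_def symX XA flip_compose)
  then show "sep_cone N A \<rho>"
  proof (rule sep_cone_cong)
    fix y z assume yz: "y \<in> basis {..<N}" "z \<in> basis {..<N}"
    have "X y = g y + h y" by (simp add: g_def h_def field_simps)
    then show "\<rho> y z =
      (of_real (D y - \<bar>g y\<bar> - \<bar>h y\<bar>) * of_bool (z = y) +
       (of_real \<bar>g y\<bar> * of_bool (z = y) + of_real (g y) * of_bool (z = flip {..<N} y))) +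
       (of_real \<bar>h y\<bar> * of_bool (z = y) + of_real (h y) * of_bool (z = flip {..<N} y))"
      using \<rho>[OF yz] by (simp add: algebra_simps)
  qed
qed

end


text \<open>Cauchy-Schwarz in each tensor factor, then the arithmetic-geometric mean inequality; this is
  the positivity of a \<open>2 \<times> 2\<close> minor of the partial transpose.\<close>

lemma separable_across_entry_bound:
  assumes sep: "separable_across N A \<rho>" and A: "A \<subseteq> {..<N}"
    and bs: "x \<in> basis {..<N}" "y \<in> basis {..<N}" "z \<in> basis {..<N}" "z' \<in> basis {..<N}"
    and z: "restrict z A = restrict x A" "restrict z ({..<N} - A) = restrict y ({..<N} - A)"
    and z': "restrict z' A = restrict y A" "restrict z' ({..<N} - A) = restrict x ({..<N} - A)"
  shows "cmod (\<rho> x y) \<le> (Re (\<rho> z z) + Re (\<rho> z' z')) / 2"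
proof -
  let ?B = "{..<N} - A"
  have fin: "finite A" "finite ?B" using A finite_subset by blast+
  obtain n w \<alpha> \<beta> where 1: "\<And>i. i < n \<Longrightarrow> 0 \<le> w i" "\<And>i. i < n \<Longrightarrow> positive_op A (\<alpha> i)"
    "\<And>i. i < n \<Longrightarrow> positive_op ?B (\<beta> i)"
    and \<rho>: "\<And>x y. x \<in> basis {..<N} \<Longrightarrow> y \<in> basis {..<N} \<Longrightarrow>
       \<rho> x y = (\<Sum>i<n::nat. of_real (w i) * tensor_op A ?B (\<alpha> i) (\<beta> i) x y)"
    using sep unfolding separable_across_def density_op_def by blast
  define T where "T i = tensor_op A ?B (\<alpha> i) (\<beta> i)" for i
  have T: "cmod (T i x y) \<le> (Re (T i z z) + Re (T i z' z')) / 2" if i: "i < n" for i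
  proof -
    define p q r s where "p = \<alpha> i (restrict x A) (restrict x A)" and "q = \<alpha> i (restrict y A) (restrict y A)"
      and "r = \<beta> i (restrict x ?B) (restrict x ?B)" and "s = \<beta> i (restrict y ?B) (restrict y ?B)"
    define k l where "k = cmod (\<alpha> i (restrict x A) (restrict y A))"
      and "l = cmod (\<beta> i (restrict x ?B) (restrict y ?B))"
    have nonneg: "p \<in> \<real>\<^sub>\<ge>\<^sub>0" "q \<in> \<real>\<^sub>\<ge>\<^sub>0" "r \<in> \<real>\<^sub>\<ge>\<^sub>0" "s \<in> \<real>\<^sub>\<ge>\<^sub>0"
      unfolding p_def q_def r_def s_def using positive_op_diag[OF 1(2)[OF i] fin(1) restrict_in_basis]
        positive_op_diag[OF 1(3)[OF i] fin(2) restrict_in_basis] by blast+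
    have k: "k\<^sup>2 \<le> Re p * Re q" and l: "l\<^sup>2 \<le> Re r * Re s"
      unfolding p_def q_def r_def s_def k_def l_def using positive_op_entry_bound[OF 1(2)[OF i] fin(1) restrict_in_basis restrict_in_basis]
        positive_op_entry_bound[OF 1(3)[OF i] fin(2) restrict_in_basis restrict_in_basis] by blast+
    have "(k * l)\<^sup>2 \<le> (Re p * Re q) * (Re r * Re s)"
      unfolding power_mult_distrib using k l by (intro mult_mono) (auto intro: order_trans[OF zero_le_power2])
    \<comment> \<open>Regrouped because \<open>p * s\<close> and \<open>q * r\<close> are the
      diagonal entries of the product at the mixed strings \<open>z\<close> and
      \<open>z'\<close>.\<close>
    also have "\<dots> = (Re p * Re s) * (Re q * Re r)" by simp
    also have "\<dots> \<le> ((Re p * Re s + Re q * Re r) / 2)\<^sup>2"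
      using zero_le_power2[of "Re p * Re s - Re q * Re r"] by (simp add: power2_eq_square field_simps)
    finally have "k * l \<le> (Re p * Re s + Re q * Re r) / 2"
      by (rule power2_le_imp_le) (use nonneg in \<open>auto simp: complex_nonneg_Reals_iff\<close>)
    moreover have "T i z z = p * s" "T i z' z' = q * r" "cmod (T i x y) = k * l"
      by (simp_all add: T_def tensor_op_def z z' p_def q_def r_def s_def k_def l_def norm_mult)
    ultimately show ?thesis
      using nonneg by (simp add: complex_nonneg_Reals_iff)
  qed
  have "cmod (\<rho> x y) \<le> (\<Sum>i<n. cmod (of_real (w i) * T i x y))"
    unfolding \<rho>[OF bs(1,2)] T_def by (rule norm_sum)
  also have "\<dots> \<le> (\<Sum>i<n. w i * ((Re (T i z z) + Re (T i z' z')) / 2))"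
  proof (rule sum_mono)
    fix i assume "i \<in> {..<n}"
    then have i: "i < n" by simp
    show "cmod (of_real (w i) * T i x y) \<le> w i * ((Re (T i z z) + Re (T i z' z')) / 2)"
      using mult_left_mono[OF T[OF i] 1(1)[OF i]] 1(1)[OF i] by (simp add: norm_mult)
  qed
  also have "\<dots> = (Re (\<rho> z z) + Re (\<rho> z' z')) / 2"
    unfolding \<rho>[OF bs(3,3)] \<rho>[OF bs(4,4)] T_def[symmetric]
    by (simp add: sum.distrib sum_divide_distrib[symmetric] distrib_left)
  finally show ?thesis .
qed

subsection \<open>Matrix entries of the noisy cat state\<close>

text \<open>Identity and z keep a matrix unit in place, x and y flip both of its indices. On
  off-diagonal units y and z also contribute a sign -1, hence the differences.\<close>

lemma pauli_channel_axis:
  "pauli_channel p (axis s (axis t 1)) $ x $ y = of_real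
     (if s = t then (if y = x then if x = s then p 0 + p 3 else p 1 + p 2 else 0)
      else (if y \<noteq> x then if x = s then p 0 - p 3 else p 1 - p 2 else 0))"
proof -
  have "(\<Sum>i=1..3. F i) = F 1 + F 2 + F 3" for F :: "nat \<Rightarrow> complex^bool^bool"
    by (simp add: eval_nat_numeral)
  then show ?thesis
    unfolding pauli_channel_def
    by (cases s; cases t; cases x; cases y)
      (simp_all add: pauli_def matrix_matrix_mult_def UNIV_bool axis_def scaleR_conv_of_real[where 'a = complex])
qed

definition ones :: "nat \<Rightarrow> (nat \<Rightarrow> bool) \<Rightarrow> nat" where
  "ones N x = card {q. q < N \<and> x q}"

lemma ones_le: "ones N x \<le> N"
  using card_mono[of "{..<N}" "{q. q < N \<and> x q}"] by (auto simp: ones_def)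

lemma prod_if_ones:
  fixes e f :: "'a::comm_monoid_mult"
  shows "(\<Prod>q<N. if x q then e else f) = e ^ ones N x * f ^ (N - ones N x)"
proof -
  have "{..<N} \<inter> {q. x q} = {q. q < N \<and> x q}" "{..<N} \<inter> - {q. x q} = {..<N} - {q. q < N \<and> x q}"
    by auto
  then show ?thesis
    by (simp add: prod.If_cases ones_def card_Diff_subset subset_iff)
qed

lemma ones_not: "ones N (\<lambda>q. \<not> x q) = N - ones N x"
proof -
  have "{q. q < N \<and> \<not> x q} = {..<N} - {q. q < N \<and> x q}"
    by auto
  then show ?thesis
    by (simp add: ones_def card_Diff_subset subset_iff)
qed

lemma ones_flip_all: "ones N (flip {..<N} x) = N - ones N x"
  unfolding ones_not[symmetric] by (simp add: ones_def flip_def cong: conj_cong)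

lemma sum_cat_state:
  assumes "0 < N"
  shows "(\<Sum>u\<in>basis {..<N}. cat_state N u * F u) =
    of_real (1 / sqrt 2) * (F (restrict (\<lambda>_. False) {..<N}) + F (restrict (\<lambda>_. True) {..<N}))"
proof -
  let ?K = "\<lambda>b. restrict (\<lambda>_. b) {..<N} :: nat \<Rightarrow> bool"
  have K: "(\<forall>q<N. u q = b) \<longleftrightarrow> u = ?K b" if "u \<in> basis {..<N}" for u b
    using that basis_eqI[OF that restrict_in_basis, of "\<lambda>_. b"] by auto
  have ne: "?K False \<noteq> ?K True"
    using assms by (auto simp: fun_eq_iff)
  have "(\<Sum>u\<in>basis {..<N}. cat_state N u * F u) = (\<Sum>u\<in>{?K False, ?K True}. cat_state N u * F u)"
    using K[of _ True] K[of _ False]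
    by (intro sum.mono_neutral_right) (auto simp: cat_state_def)
  also have "\<dots> = of_real (1 / sqrt 2) * (F (?K False) + F (?K True))"
    using ne assms by (auto simp: cat_state_def algebra_simps)
  finally show ?thesis .
qed

text \<open>One qubit at which \<open>y\<close> breaks the required pattern already contributes a
  zero factor.\<close>

lemma prod_pauli_channel_axis:
  assumes x: "x \<in> basis {..<N}" and y: "y \<in> basis {..<N}"
  shows "(\<Prod>q<N. pauli_channel p (axis b (axis b 1)) $ x q $ y q) =
      of_real (\<Prod>q<N. if x q = b then p 0 + p 3 else p 1 + p 2) * of_bool (y = x)"
    and "(\<Prod>q<N. pauli_channel p (axis b (axis (\<not> b) 1)) $ x q $ y q) =
      of_real (\<Prod>q<N. if x q = b then p 0 - p 3 else p 1 - p 2) * of_bool (y = flip {..<N} x)"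
proof -
  show "(\<Prod>q<N. pauli_channel p (axis b (axis b 1)) $ x q $ y q) =
      of_real (\<Prod>q<N. if x q = b then p 0 + p 3 else p 1 + p 2) * of_bool (y = x)"
  proof (cases "y = x")
    case True
    then show ?thesis by (simp add: pauli_channel_axis)
  next
    case False
    then obtain q where "q < N" "y q \<noteq> x q"
      using basis_eqI[OF y x] by auto
    then show ?thesis
      using False by (auto simp: pauli_channel_axis intro!: prod_zero)
  qed
  show "(\<Prod>q<N. pauli_channel p (axis b (axis (\<not> b) 1)) $ x q $ y q) =
      of_real (\<Prod>q<N. if x q = b then p 0 - p 3 else p 1 - p 2) * of_bool (y = flip {..<N} x)"
  proof (cases "y = flip {..<N} x")
    case True
    then show ?thesis
      unfolding of_real_prod by (auto simp: pauli_channel_axis flip_def intro!: prod.cong)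
  next
    case False
    then obtain q where "q < N" "y q \<noteq> flip {..<N} x q"
      using basis_eqI[OF y flip_in_basis[OF subset_refl x]] by auto
    then show ?thesis
      using False by (auto simp: pauli_channel_axis flip_def intro!: prod_zero)
  qed
qed

text \<open>The cat projector has four matrix units: the two diagonal ones produce the diagonal
  weights, the two off-diagonal ones the antidiagonal weights.\<close>

lemma noisy_cat_entry:
  assumes N: "0 < N" and x: "x \<in> basis {..<N}" and y: "y \<in> basis {..<N}"
  shows "noisy_cat N p x y =
    of_real (mix (p 0 + p 3) (p 1 + p 2) N (ones N x)) * of_bool (y = x) +
    of_real (mix (p 0 - p 3) (p 1 - p 2) N (ones N x)) * of_bool (y = flip {..<N} x)"
proof -
  define P where "P s t = (\<Prod>q<N. pauli_channel p (axis s (axis t 1)) $ x q $ y q)" for s t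
  define Q where "Q u v = (\<Prod>q<N. pauli_channel p (axis (u q) (axis (v q) 1)) $ x q $ y q)"
    for u v :: "nat \<Rightarrow> bool"
  let ?K = "\<lambda>b. restrict (\<lambda>_. b) {..<N} :: nat \<Rightarrow> bool"
  have cnj: "cnj (cat_state N v) = cat_state N v" for v
    by (simp add: cat_state_def)
  have Q: "Q (?K s) (?K t) = P s t" for s t
    unfolding P_def Q_def by (intro prod.cong) auto
  have "noisy_cat N p x y = (\<Sum>u\<in>basis {..<N}. cat_state N u * (\<Sum>v\<in>basis {..<N}. cat_state N v * Q u v))"
    unfolding noisy_cat_def channel_power_def Q_def sum_distrib_left by (simp add: cnj mult.assoc)
  also have "\<dots> = of_real (1 / sqrt 2) * (of_real (1 / sqrt 2) * (P False False + P False True)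
       + of_real (1 / sqrt 2) * (P True False + P True True))"
    by (simp only: sum_cat_state[OF N] Q)
  also have "\<dots> = of_real (1 / sqrt 2 * (1 / sqrt 2)) * (P False False + P False True + P True False + P True True)"
    by (simp only: of_real_mult) (simp add: algebra_simps add_divide_distrib)
  also have "1 / sqrt 2 * (1 / sqrt 2) = (1 / 2 :: real)" by simp
  finally have "noisy_cat N p x y = of_real (1 / 2) * (P False False + P False True + P True False + P True True)" .
  then show ?thesis
    using prod_pauli_channel_axis[OF x y, of p False] prod_pauli_channel_axis[OF x y, of p True]
    by (simp add: P_def mix_def prod_if_ones ones_not ones_le algebra_simps add_divide_distrib)
qed

text \<open>No string equals its complement, so only diagonal weights enter; they sum by the
  binomial expansion of \<open>(a + b)^N\<close> with \<open>a + b = 1\<close>.\<close>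

lemma trace_noisy_cat:
  assumes N: "0 < N" and p: "p 0 + p 1 + p 2 + p 3 = 1"
  shows "(\<Sum>x\<in>basis {..<N}. noisy_cat N p x x) = 1"
proof -
  have binom: "(\<Sum>x\<in>basis {..<N}. e ^ ones N x * f ^ (N - ones N x)) = (e + f) ^ N" for e f :: real
  proof -
    have "(e + f) ^ N = (\<Prod>q<N. \<Sum>b\<in>UNIV. if b then e else f)"
      by (simp add: UNIV_bool add.commute)
    also have "\<dots> = (\<Sum>x\<in>basis {..<N}. \<Prod>q<N. if x q then e else f)"
      unfolding basis_def by (rule prod_sum_PiE) auto
    finally show ?thesis by (simp add: prod_if_ones)
  qed
  let ?a = "p 0 + p 3" and ?b = "p 1 + p 2"
  have "x \<noteq> flip {..<N} x" for x
    using N flip_eq_self_iff[of "{..<N}" x] by auto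
  then have "(\<Sum>x\<in>basis {..<N}. noisy_cat N p x x) = of_real (\<Sum>x\<in>basis {..<N}. mix ?a ?b N (ones N x))"
    using N by (simp add: noisy_cat_entry)
  also have "(\<Sum>x\<in>basis {..<N}. mix ?a ?b N (ones N x)) = ((?a + ?b) ^ N + (?b + ?a) ^ N) / 2"
    unfolding mix_def binom[symmetric] sum_divide_distrib[symmetric] sum.distrib[symmetric]
    by (simp add: mult.commute add.commute)
  also have "\<dots> = 1"
  proof -
    have "?a + ?b = 1" "?b + ?a = 1" using p by auto
    then show ?thesis by (simp only: power_one) simp
  qed
  finally show ?thesis by simp
qed

subsection \<open>The separability criterion\<close>

lemma ones_split:
  assumes "A \<subseteq> {..<N}"
  shows "ones N x = card {q\<in>A. x q} + card {q\<in>{..<N} - A. x q}"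
    and "ones N (flip A x) = card A - card {q\<in>A. x q} + card {q\<in>{..<N} - A. x q}"
proof -
  have fin: "finite A" using assms finite_subset by blast
  have "{q. q < N \<and> x q} = {q\<in>A. x q} \<union> {q\<in>{..<N} - A. x q}" using assms by auto
  then show "ones N x = card {q\<in>A. x q} + card {q\<in>{..<N} - A. x q}"
    unfolding ones_def using fin by (simp add: card_Un_disjoint disjoint_iff)
  have "{q. q < N \<and> flip A x q} = (A - {q\<in>A. x q}) \<union> {q\<in>{..<N} - A. x q}"
    using assms by (auto simp: flip_def)
  moreover have "(A - {q\<in>A. x q}) \<inter> {q\<in>{..<N} - A. x q} = {}" by auto
  moreover have "card (A - {q\<in>A. x q}) = card A - card {q\<in>A. x q}"
    using fin by (intro card_Diff_subset) auto
  ultimately show "ones N (flip A x) = card A - card {q\<in>A. x q} + card {q\<in>{..<N} - A. x q}"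
    unfolding ones_def using fin by (simp add: card_Un_disjoint)
qed

theorem separable_noisy_cat_iff:
  assumes cut: "bipartite_cut N k A"
    and p: "\<And>i. i \<le> 3 \<Longrightarrow> 0 \<le> p i" "p 0 + p 1 + p 2 + p 3 = 1"
  shows "separable_across N A (noisy_cat N p) \<longleftrightarrow>
    ppt_bound (p 0 + p 3) (p 1 + p 2) (p 0 - p 3) (p 1 - p 2) N k"
proof -
  let ?D = "mix (p 0 + p 3) (p 1 + p 2) N" and ?X = "mix (p 0 - p 3) (p 1 - p 2) N"
  let ?B = "{..<N} - A"
  have A: "A \<subseteq> {..<N}" "card A = k" and k: "0 < k" "k < N"
    using cut by (auto simp: bipartite_cut_def)
  have fin: "finite A" using A finite_subset by blast
  have cB: "card ?B = N - k" using A fin by (simp add: card_Diff_subset)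
  have N: "0 < N" using k by simp
  have nA: "A \<noteq> {}" "A \<noteq> {..<N}" using A k by auto
  note fl = flip_compose[OF A(1) nA]
  show ?thesis
  proof
    assume sep: "separable_across N A (noisy_cat N p)"
    show "ppt_bound (p 0 + p 3) (p 1 + p 2) (p 0 - p 3) (p 1 - p 2) N k"
      unfolding ppt_bound_def
    proof (intro allI impI)
      fix i j assume ij: "i \<le> k" "j \<le> N - k"
      obtain S where S: "S \<subseteq> A" "card S = i"
        using obtain_subset_with_card_n[of i A] ij A by auto
      obtain T where T: "T \<subseteq> ?B" "card T = j"
        using obtain_subset_with_card_n[of j ?B] ij cB by auto
      \<comment> \<open>A representative with \<open>i\<close> ones inside \<open>A\<close> and
        \<open>j\<close> ones outside.\<close>
      define z where "z = restrict (\<lambda>q. q \<in> S \<union> T) {..<N}"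
      have z: "z \<in> basis {..<N}" by (simp add: z_def)
      have "{q\<in>A. z q} = S" "{q\<in>?B. z q} = T"
        using S T A by (auto simp: z_def)
      then have o: "ones N z = i + j" "ones N (flip A z) = k - i + j"
        using ones_split[OF A(1), of z] S T A by simp_all
      \<comment> \<open>Exchanging the \<open>A\<close> parts of \<open>flip A z\<close> and its
        complement \<open>flip ?B z\<close> produces \<open>z\<close> and
        \<open>flip {..<N} z\<close>, whose diagonal weights agree by reflection.\<close>
      have "cmod (noisy_cat N p (flip A z) (flip ?B z)) \<le>
          (Re (noisy_cat N p (flip {..<N} z) (flip {..<N} z)) + Re (noisy_cat N p z z)) / 2"
        using A z by (intro separable_across_entry_bound[OF sep A(1)] flip_in_basis)
          (auto simp: flip_def fun_eq_iff)
      moreover have "noisy_cat N p (flip A z) (flip ?B z) = of_real (?X (k - i + j))"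
        using N z A by (simp add: noisy_cat_entry fl o flip_distinct_sym[OF A(1) nA])
      moreover have "noisy_cat N p z z = of_real (?D (i + j))"
        using N z by (simp add: noisy_cat_entry o flip_distinct_sym[OF A(1) nA])
      moreover have "noisy_cat N p (flip {..<N} z) (flip {..<N} z) = of_real (?D (i + j))"
        using N z ij k by (simp add: noisy_cat_entry o ones_flip_all fl mix_reflect flip_distinct_sym[OF A(1) nA])
      ultimately show "\<bar>?X (k - i + j)\<bar> \<le> ?D (i + j)" by simp
    qed
  next
    assume C: "ppt_bound (p 0 + p 3) (p 1 + p 2) (p 0 - p 3) (p 1 - p 2) N k"
    show "separable_across N A (noisy_cat N p)"
    proof (rule separable_across_X_state[OF A(1) nA,
          where D = "\<lambda>y. ?D (ones N y)" and X = "\<lambda>y. ?X (ones N y)"])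
      show "(\<Sum>y\<in>basis {..<N}. noisy_cat N p y y) = 1"
        by (rule trace_noisy_cat[OF N p(2)])
    next
      fix y
      have "card {q\<in>A. y q} \<le> k" "card {q\<in>?B. y q} \<le> N - k"
        using card_mono[OF fin, of "{q\<in>A. y q}"] card_mono[of ?B "{q\<in>?B. y q}"] A cB by auto
      from ppt_boundD[OF C this] show "\<bar>?X (ones N (flip A y))\<bar> \<le> ?D (ones N y)"
        using ones_split[OF A(1), of y] A by simp
      show "\<bar>?X (ones N y)\<bar> \<le> ?D (ones N y)"
        using p(1)[of 0] p(1)[of 1] p(1)[of 2] p(1)[of 3] by (intro abs_mix_le_mix) auto
    qed (simp_all add: noisy_cat_entry[OF N] ones_flip_all mix_reflect ones_le)
  qed
qed

theorem corollary1:
  fixes N :: nat and p :: "nat \<Rightarrow> real"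
  assumes "N \<ge> 2"
    and "\<And>i. i \<le> 3 \<Longrightarrow> 0 \<le> p i"
    and "(\<Sum>i=0..3. p i) = 1"
  shows
    "(\<forall>A. bipartite_cut N 1 A \<and> entangled_across N A (noisy_cat N p) \<longrightarrow>
        (\<forall>k B. bipartite_cut N k B \<longrightarrow> entangled_across N B (noisy_cat N p))) \<and>
     ((\<exists>k A. bipartite_cut N k A \<and> entangled_across N A (noisy_cat N p)) \<longrightarrow>
        (\<forall>k B. k \<in> {N div 2, N - N div 2} \<and> bipartite_cut N k B \<longrightarrow>
           entangled_across N B (noisy_cat N p)))"
proof -
  have p: "p 0 + p 1 + p 2 + p 3 = 1"
    using assms(3) by (simp add: eval_nat_numeral)
  have ab: "0 \<le> p 0 + p 3" "0 \<le> p 1 + p 2"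
    using assms(2)[of 0] assms(2)[of 1] assms(2)[of 2] assms(2)[of 3] by auto
  \<comment> \<open>The criterion sees a cut only through its size, so both claims become, by
    contraposition, implications between \<open>ppt_bound\<close> for different sizes.\<close>
  note crit = separable_noisy_cat_iff[OF _ assms(2) p]
  have cut: "1 \<le> k" "k < N" "k \<le> N" if "bipartite_cut N k A" for k A
    using that by (auto simp: bipartite_cut_def)
  show ?thesis
  proof (intro conjI allI impI)
    fix A k B assume "bipartite_cut N 1 A \<and> entangled_across N A (noisy_cat N p)" "bipartite_cut N k B"
    then show "entangled_across N B (noisy_cat N p)"
      using ppt_bound_imp_one[OF _ cut(1,2) ab] crit by blast
  next
    fix k B assume "\<exists>k A. bipartite_cut N k A \<and> entangled_across N A (noisy_cat N p)"
      and "k \<in> {N div 2, N - N div 2} \<and> bipartite_cut N k B"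
    then show "entangled_across N B (noisy_cat N p)"
      using ppt_bound_half_imp[OF _ _ cut(3) ab] crit by blast
  qed
qed

end
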